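(* Let $F$ be an ordered field with an integer part $I$, and suppose that $I\models IE_{1}$. If $\alpha\in F\setminus\mathrm{Frac}(I)$, then for every $Q\in I^{>0}$ there exist $p,q\in I$ with $1\leqslant q\leqslant Q$, $(p,q)=1$ and $$\Big|\frac{p}{q}-\alpha\Big|\leqslant\frac{1}{qQ}.$$
   Context: A subring $I$ of an ordered field $F$ is an integer part of $F$ if $I$ is discretely ordered (no $x\in I$ satisfies $0<x<1$) and for every $x\in F$ there is $a\in I$ with $a\leqslant x<a+1$. $I^{>0}$ is the set of positive elements of $I$, $\mathrm{Frac}(I)\subseteq F$ is its fraction field, and $(p,q)=1$ means that $p,q$ have greatest common divisor $1$ in $I$. Let $L=\{+,-,\cdot,0,1,\leqslant\}$ be the language of ordered rings. An $E_1$-formula is one of the form $\exists\bar{y}\leqslant t(\bar{x})\,\phi(\bar{x},\bar{y})$ with $\phi$ a quantifier-free $L$-formula and $t$ an $L$-term, where the bounded variables range over nonnegative elements ($0\leqslant y_i\leqslant t(\bar x)$). $IE_1$ (bounded existential induction) is the theory of discretely ordered rings together with, for each $E_1$-formula $\varphi(\vec{x},y)$, the axiom $$\forall\vec{x}\,\big(\varphi(\vec{x},0)\wedge\forall y\geqslant 0\,(\varphi(\vec{x},y)\rightarrow\varphi(\vec{x},y+1))\rightarrow\forall y\geqslant 0\,\varphi(\vec{x},y)\big).$$ *)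

theory Defs
  imports Main
begin

text \<open>Subrings of an ordered field are sets in a type of class
  \<^class>\<open>linordered_field\<close>; the type itself is the field.\<close>

definition is_subring :: "'a::linordered_field set \<Rightarrow> bool" where
  "is_subring I \<longleftrightarrow>
     0 \<in> I \<and> 1 \<in> I \<and>
     (\<forall>x\<in>I. \<forall>y\<in>I. x + y \<in> I) \<and>
     (\<forall>x\<in>I. \<forall>y\<in>I. x * y \<in> I) \<and>
     (\<forall>x\<in>I. - x \<in> I)"

definition discretely_ordered :: "'a::linordered_field set \<Rightarrow> bool" where
  "discretely_ordered I \<longleftrightarrow> is_subring I \<and> \<not> (\<exists>x\<in>I. 0 < x \<and> x < 1)"

definition integer_part :: "'a::linordered_field set \<Rightarrow> bool" where
  "integer_part I \<longleftrightarrow>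
     discretely_ordered I \<and> (\<forall>x. \<exists>a\<in>I. a \<le> x \<and> x < a + 1)"

definition Frac :: "'a::linordered_field set \<Rightarrow> 'a set" where
  "Frac I = {a / b | a b. a \<in> I \<and> b \<in> I \<and> b \<noteq> 0}"

text \<open>Divisibility is that of the ring \<open>I\<close>: the cofactor must lie in \<open>I\<close>.\<close>

definition dvd_in :: "'a::linordered_field set \<Rightarrow> 'a \<Rightarrow> 'a \<Rightarrow> bool" where
  "dvd_in I d x \<longleftrightarrow> (\<exists>c\<in>I. x = d * c)"

definition is_gcd_in :: "'a::linordered_field set \<Rightarrow> 'a \<Rightarrow> 'a \<Rightarrow> 'a \<Rightarrow> bool" where
  "is_gcd_in I g p q \<longleftrightarrow>
     g \<in> I \<and> dvd_in I g p \<and> dvd_in I g q \<and>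
     (\<forall>d\<in>I. dvd_in I d p \<and> dvd_in I d q \<longrightarrow> dvd_in I d g)"

text \<open>First-order logic over the language \<open>{+, -, \<cdot>, 0, 1, \<le>}\<close> with named variables.
  The symbol \<open>-\<close> is binary; the negative of \<open>t\<close> is \<open>0 - t\<close>.\<close>

datatype trm =
    TVar nat
  | TZero
  | TOne
  | TAdd trm trm
  | TSub trm trm
  | TMul trm trm

datatype fm =
    FEq trm trm
  | FLe trm trm
  | FNeg fm
  | FConj fm fm
  | FDisj fm fm
  | FEx nat fm
  | FAll nat fm

fun trm_vars :: "trm \<Rightarrow> nat set" where
  "trm_vars (TVar n) = {n}"
| "trm_vars TZero = {}"
| "trm_vars TOne = {}"
| "trm_vars (TAdd s t) = trm_vars s \<union> trm_vars t"
| "trm_vars (TSub s t) = trm_vars s \<union> trm_vars t"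
| "trm_vars (TMul s t) = trm_vars s \<union> trm_vars t"

fun quantifier_free :: "fm \<Rightarrow> bool" where
  "quantifier_free (FEq s t) = True"
| "quantifier_free (FLe s t) = True"
| "quantifier_free (FNeg f) = quantifier_free f"
| "quantifier_free (FConj f g) = (quantifier_free f \<and> quantifier_free g)"
| "quantifier_free (FDisj f g) = (quantifier_free f \<and> quantifier_free g)"
| "quantifier_free (FEx n f) = False"
| "quantifier_free (FAll n f) = False"

fun trm_val :: "(nat \<Rightarrow> 'a::linordered_field) \<Rightarrow> trm \<Rightarrow> 'a" where
  "trm_val e (TVar n) = e n"
| "trm_val e TZero = 0"
| "trm_val e TOne = 1"
| "trm_val e (TAdd s t) = trm_val e s + trm_val e t"
| "trm_val e (TSub s t) = trm_val e s - trm_val e t"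
| "trm_val e (TMul s t) = trm_val e s * trm_val e t"

text \<open>Satisfaction in the structure with universe \<open>I\<close>, whose operations and order are
  those of the surrounding field; quantifiers range over \<open>I\<close>.\<close>

fun sat :: "'a::linordered_field set \<Rightarrow> (nat \<Rightarrow> 'a) \<Rightarrow> fm \<Rightarrow> bool" where
  "sat I e (FEq s t) \<longleftrightarrow> trm_val e s = trm_val e t"
| "sat I e (FLe s t) \<longleftrightarrow> trm_val e s \<le> trm_val e t"
| "sat I e (FNeg f) \<longleftrightarrow> \<not> sat I e f"
| "sat I e (FConj f g) \<longleftrightarrow> sat I e f \<and> sat I e g"
| "sat I e (FDisj f g) \<longleftrightarrow> sat I e f \<or> sat I e g"
| "sat I e (FEx n f) \<longleftrightarrow> (\<exists>a\<in>I. sat I (e(n := a)) f)"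
| "sat I e (FAll n f) \<longleftrightarrow> (\<forall>a\<in>I. sat I (e(n := a)) f)"

definition bounded_ex :: "trm \<Rightarrow> nat \<Rightarrow> fm \<Rightarrow> fm" where
  "bounded_ex t y f =
     FEx y (FConj (FConj (FLe TZero (TVar y)) (FLe (TVar y) t)) f)"

text \<open>The bounding term must not mention the bounded variables. It may mention any other
  variable, including the one on which induction is done in \<open>models_IE1\<close>.\<close>

definition E1_formula :: "fm \<Rightarrow> bool" where
  "E1_formula \<phi> \<longleftrightarrow>
     (\<exists>ys t \<psi>. quantifier_free \<psi> \<and> trm_vars t \<inter> set ys = {} \<and>
              \<phi> = foldr (bounded_ex t) ys \<psi>)"

text \<open>The parameters and the free variable \<open>y\<close> are given by an assignment \<open>e\<close> into \<open>I\<close>;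
  substituting a value for \<open>y\<close> amounts to updating \<open>e\<close> at \<open>y\<close>.\<close>

definition models_IE1 :: "'a::linordered_field set \<Rightarrow> bool" where
  "models_IE1 I \<longleftrightarrow>
     discretely_ordered I \<and>
     (\<forall>\<phi> y e. E1_formula \<phi> \<longrightarrow> (\<forall>n. e n \<in> I) \<longrightarrow>
        sat I (e(y := 0)) \<phi> \<and>
        (\<forall>b\<in>I. 0 \<le> b \<longrightarrow> sat I (e(y := b)) \<phi> \<longrightarrow> sat I (e(y := b + 1)) \<phi>) \<longrightarrow>
        (\<forall>b\<in>I. 0 \<le> b \<longrightarrow> sat I (e(y := b)) \<phi>))"

end

theory Submission
  imports Defs
begin

text \<open>
  The classical proof through Farey fractions works here once \<open>\<alpha>\<close> is replaced by a nearby
  quotient of elements of \<open>I\<close>. Call \<open>a / b\<close> and \<open>c / d\<close> Farey neighbours of order \<open>k\<close> if \<open>b * c - a * d = 1\<close>,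
  both denominators are at most \<open>k\<close>, and their sum exceeds \<open>k\<close>. If \<open>\<alpha>\<close> lies between Farey
  neighbours of order \<open>Q\<close>, compare it with the mediant \<open>(a + c) / (b + d)\<close>: from the neighbour
  on the same side of the mediant, of denominator \<open>q\<close> say, \<open>\<alpha>\<close> differs by at most
  \<open>1 / (q * (b + d))\<close>, hence by at most \<open>1 / (q * Q)\<close>. The equation \<open>b * c - a * d = 1\<close> also makes
  both fractions reduced.

  Neighbours of order \<open>k\<close> are found by induction on \<open>k\<close>, replacing one of them by the mediant as
  soon as \<open>b + d = k + 1\<close>. Such an induction is available in \<open>I\<close> only for \<open>E\<^sub>1\<close>-formulas with
  parameters from \<open>I\<close>, and \<open>\<alpha>\<close> is not in \<open>I\<close>. Therefore the fractions are made to enclose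
  \<open>m / N\<close> instead, where \<open>N = Q * Q\<close> and \<open>m\<close> is the integer part of \<open>N * \<alpha>\<close>; the four numbers
  \<open>a, b, c, d\<close> are then witnesses of a bounded existential formula (lemma
  \<open>farey_neighbours_exist\<close>). Since \<open>m / N \<le> \<alpha> < (m + 1) / N\<close>, the only way for \<open>\<alpha>\<close> to escape from
  the interval between \<open>a / b\<close> and \<open>c / d\<close> is \<open>m / N \<le> c / d < \<alpha> < (m + 1) / N\<close>, and then \<open>c / d\<close>
  itself is within \<open>1 / N \<le> 1 / (d * Q)\<close> of \<open>\<alpha>\<close> (lemma \<open>farey_neighbour_approximates\<close>).
  Bounded variables are nonnegative, so this is done for \<open>0 \<le> \<alpha> < 1\<close>; subtracting an element of
  \<open>I\<close> from \<open>\<alpha>\<close> reduces the general case to this one.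
\<close>

lemma discretely_orderedD:
  assumes "discretely_ordered I"
  shows "0 \<in> I" "1 \<in> I"
    and "\<And>x y. x \<in> I \<Longrightarrow> y \<in> I \<Longrightarrow> x + y \<in> I"
    and "\<And>x y. x \<in> I \<Longrightarrow> y \<in> I \<Longrightarrow> x - y \<in> I"
    and "\<And>x y. x \<in> I \<Longrightarrow> y \<in> I \<Longrightarrow> x * y \<in> I"
proof -
  have sub: "is_subring I"
    using assms by (simp add: discretely_ordered_def)
  then show "0 \<in> I" "1 \<in> I"
    and add: "\<And>x y. x \<in> I \<Longrightarrow> y \<in> I \<Longrightarrow> x + y \<in> I"
    and "\<And>x y. x \<in> I \<Longrightarrow> y \<in> I \<Longrightarrow> x * y \<in> I"
    by (auto simp: is_subring_def)
  show "x - y \<in> I" if "x \<in> I" "y \<in> I" for x y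
    using add[of x "- y"] sub that by (simp add: is_subring_def)
qed

lemma discretely_ordered_less_imp_add1_le:
  assumes "discretely_ordered I" "x \<in> I" "y \<in> I" "x < y"
  shows "x + 1 \<le> y"
proof (rule ccontr)
  assume "\<not> x + 1 \<le> y"
  then have "0 < y - x" "y - x < 1"
    using assms(4) by (auto simp: algebra_simps)
  moreover have "y - x \<in> I"
    using assms by (simp add: discretely_orderedD)
  ultimately show False
    using assms(1) unfolding discretely_ordered_def by blast
qed

section \<open>Farey neighbours\<close>

text \<open>The inequalities \<open>a \<le> b\<close> and \<open>c \<le> d\<close> restrict attention to the interval from \<open>0\<close> to \<open>1\<close>;
  with them all four numbers lie between \<open>0\<close> and \<open>k\<close>, as a bounded quantifier requires. The last
  two conjuncts say \<open>a / b \<le> m / N \<le> c / d\<close>, in a form expressible by polynomials.\<close>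

definition farey_neighbours ::
    "'a::linordered_field \<Rightarrow> 'a \<Rightarrow> 'a \<Rightarrow> 'a \<Rightarrow> 'a \<Rightarrow> 'a \<Rightarrow> 'a \<Rightarrow> bool" where
  "farey_neighbours m N k a b c d \<longleftrightarrow>
     0 \<le> a \<and> a \<le> b \<and> 1 \<le> b \<and> b \<le> k \<and> 0 \<le> c \<and> c \<le> d \<and> 1 \<le> d \<and> d \<le> k \<and>
     b * c - a * d = 1 \<and> k + 1 \<le> b + d \<and> a * N \<le> m * b \<and> m * d \<le> c * N"

lemma farey_neighbours_succ:
  assumes I: "discretely_ordered I"
    and mem: "k \<in> I" "a \<in> I" "b \<in> I" "c \<in> I" "d \<in> I"
    and nb: "farey_neighbours m N k a b c d"
  shows "\<exists>a'\<in>I. \<exists>b'\<in>I. \<exists>c'\<in>I. \<exists>d'\<in>I. farey_neighbours m N (k + 1) a' b' c' d'"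
proof (cases "k + 1 < b + d")
  case True
  have "k + 1 + 1 \<le> b + d"
    using I mem True by (intro discretely_ordered_less_imp_add1_le) (auto intro: discretely_orderedD)
  then have "farey_neighbours m N (k + 1) a b c d"
    using nb by (auto simp: farey_neighbours_def)
  then show ?thesis
    using mem by blast
next
  case False
  then have sum: "k = b + d - 1"
    using nb by (auto simp: farey_neighbours_def)
  have mem': "a + c \<in> I" "b + d \<in> I"
    using I mem by (auto intro: discretely_orderedD)
  show ?thesis
  proof (cases "(a + c) * N \<le> m * (b + d)")
    case True
    have "farey_neighbours m N (k + 1) (a + c) (b + d) c d"
      using nb sum True by (auto simp: farey_neighbours_def algebra_simps)
    then show ?thesis
      using mem mem' by blast
  next
    case False
    have "farey_neighbours m N (k + 1) a b (a + c) (b + d)"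
      using nb sum False by (auto simp: farey_neighbours_def algebra_simps)
    then show ?thesis
      using mem mem' by blast
  qed
qed

section \<open>Existence by bounded existential induction\<close>

text \<open>Variable \<open>0\<close> holds \<open>k - 1\<close>, so that the induction, which begins with the value \<open>0\<close>, begins
  with order \<open>1\<close>; variables \<open>1\<close> to \<open>4\<close> hold \<open>a, b, c, d\<close>, and \<open>5\<close> and \<open>6\<close> the parameters
  \<open>m\<close> and \<open>N\<close>.\<close>

definition farey_matrix :: fm where
  "farey_matrix =
     foldr FConj
       [FLe (TVar 1) (TVar 2), FLe TOne (TVar 2), FLe (TVar 3) (TVar 4), FLe TOne (TVar 4),
        FEq (TSub (TMul (TVar 2) (TVar 3)) (TMul (TVar 1) (TVar 4))) TOne,
        FLe (TAdd (TAdd (TVar 0) TOne) TOne) (TAdd (TVar 2) (TVar 4)),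
        FLe (TMul (TVar 1) (TVar 6)) (TMul (TVar 5) (TVar 2))]
       (FLe (TMul (TVar 5) (TVar 4)) (TMul (TVar 3) (TVar 6)))"

definition farey_formula :: fm where
  "farey_formula = foldr (bounded_ex (TAdd (TVar 0) TOne)) [1, 2, 3, 4] farey_matrix"

lemma E1_farey_formula: "E1_formula farey_formula"
  unfolding E1_formula_def
proof (intro exI conjI)
  show "farey_formula = foldr (bounded_ex (TAdd (TVar 0) TOne)) [1, 2, 3, 4] farey_matrix"
    by (rule farey_formula_def)
qed (simp_all add: farey_matrix_def)

lemma sat_farey_formula:
  "sat I e farey_formula \<longleftrightarrow>
     (\<exists>a\<in>I. \<exists>b\<in>I. \<exists>c\<in>I. \<exists>d\<in>I. farey_neighbours (e 5) (e 6) (e 0 + 1) a b c d)"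
  (is "_ = ?R")
proof -
  have "sat I e farey_formula \<longleftrightarrow>
    (\<exists>a\<in>I. (0 \<le> a \<and> a \<le> e 0 + 1) \<and>
      (\<exists>b\<in>I. (0 \<le> b \<and> b \<le> e 0 + 1) \<and>
        (\<exists>c\<in>I. (0 \<le> c \<and> c \<le> e 0 + 1) \<and>
          (\<exists>d\<in>I. (0 \<le> d \<and> d \<le> e 0 + 1) \<and>
            a \<le> b \<and> 1 \<le> b \<and> c \<le> d \<and> 1 \<le> d \<and> b * c - a * d = 1 \<and>
            e 0 + 1 + 1 \<le> b + d \<and> a * e 6 \<le> e 5 * b \<and> e 5 * d \<le> c * e 6))))"
    by (simp add: farey_formula_def farey_matrix_def bounded_ex_def)
  also have "\<dots> \<longleftrightarrow> (\<exists>a\<in>I. \<exists>b\<in>I. \<exists>c\<in>I. \<exists>d\<in>I.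
      (0 \<le> a \<and> a \<le> e 0 + 1) \<and> (0 \<le> b \<and> b \<le> e 0 + 1) \<and> (0 \<le> c \<and> c \<le> e 0 + 1) \<and>
      (0 \<le> d \<and> d \<le> e 0 + 1) \<and>
      a \<le> b \<and> 1 \<le> b \<and> c \<le> d \<and> 1 \<le> d \<and> b * c - a * d = 1 \<and>
      e 0 + 1 + 1 \<le> b + d \<and> a * e 6 \<le> e 5 * b \<and> e 5 * d \<le> c * e 6)"
    by blast
  also have "\<dots> \<longleftrightarrow> ?R"
    unfolding farey_neighbours_def by (intro bex_cong refl) auto
  finally show ?thesis .
qed

lemma farey_neighbours_exist:
  assumes IE1: "models_IE1 I"
    and mem: "m \<in> I" "N \<in> I" "k \<in> I"
    and bounds: "0 \<le> m" "m \<le> N" "1 \<le> k"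
  shows "\<exists>a\<in>I. \<exists>b\<in>I. \<exists>c\<in>I. \<exists>d\<in>I. farey_neighbours m N k a b c d"
proof -
  have I: "discretely_ordered I"
    using IE1 by (simp add: models_IE1_def)
  note I_intros = discretely_orderedD[OF I]
  define e :: "nat \<Rightarrow> 'a" where "e = (\<lambda>_. 0)(5 := m, 6 := N)"
  have sat_iff: "sat I (e(0 := y)) farey_formula \<longleftrightarrow>
      (\<exists>a\<in>I. \<exists>b\<in>I. \<exists>c\<in>I. \<exists>d\<in>I. farey_neighbours m N (y + 1) a b c d)" for y
    by (simp add: sat_farey_formula e_def)
  have "e n \<in> I" for n
    using mem I_intros(1) by (simp add: e_def)
  moreover have "sat I (e(0 := 0)) farey_formula"
  proof -
    have "farey_neighbours m N (0 + 1) 0 1 1 1"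
      using bounds by (simp add: farey_neighbours_def)
    then show ?thesis
      unfolding sat_iff using I_intros(1,2) by blast
  qed
  moreover have "sat I (e(0 := y + 1)) farey_formula"
    if y: "y \<in> I" and sat_y: "sat I (e(0 := y)) farey_formula" for y
  proof -
    obtain a b c d where "a \<in> I" "b \<in> I" "c \<in> I" "d \<in> I"
      "farey_neighbours m N (y + 1) a b c d"
      using sat_y unfolding sat_iff by blast
    with I_intros(3)[OF y I_intros(2)] show ?thesis
      unfolding sat_iff by (rule farey_neighbours_succ[OF I])
  qed
  ultimately have all: "sat I (e(0 := y)) farey_formula" if "y \<in> I" "0 \<le> y" for y
    using IE1[unfolded models_IE1_def, THEN conjunct2, rule_format,
        OF E1_farey_formula, of e 0] that by blast
  from all[of "k - 1"] show ?thesis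
    using mem(3) bounds(3) I_intros(2,4) unfolding sat_iff by simp
qed

section \<open>Approximation\<close>

lemma is_gcd_in_one_if_det_eq_one:
  assumes I: "discretely_ordered I"
    and mem: "p \<in> I" "q \<in> I" "r \<in> I" "s \<in> I"
    and det: "p * r + q * s = 1"
  shows "is_gcd_in I 1 p q"
proof -
  note I_intros = discretely_orderedD[OF I]
  have "dvd_in I t 1" if t: "dvd_in I t p" "dvd_in I t q" for t
  proof -
    obtain u v where uv: "u \<in> I" "v \<in> I" "p = t * u" "q = t * v"
      using t unfolding dvd_in_def by blast
    then have "1 = t * (u * r + v * s)"
      using det by (simp add: algebra_simps)
    then show ?thesis
      unfolding dvd_in_def using uv mem I_intros(3,5) by blast
  qed
  then show ?thesis
    using mem I_intros(2) by (auto simp: is_gcd_in_def dvd_in_def)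
qed

text \<open>The neighbours enclose only \<open>m / (Q * Q)\<close>, so \<open>\<alpha>\<close> may exceed \<open>c / d\<close>. The denominator
  \<open>Q * Q\<close> makes that excess small enough, because \<open>d \<le> Q\<close>; otherwise the distance of the mediant
  from each neighbour gives the bound.\<close>

lemma farey_neighbour_approximates:
  fixes \<alpha> :: "'a::linordered_field"
  assumes nb: "farey_neighbours m (Q * Q) Q a b c d"
    and Q: "0 < Q"
    and floor: "m \<le> \<alpha> * (Q * Q)" "\<alpha> * (Q * Q) < m + 1"
  shows "\<bar>a / b - \<alpha>\<bar> \<le> 1 / (b * Q) \<or> \<bar>c / d - \<alpha>\<bar> \<le> 1 / (d * Q)"
proof -
  have pos: "0 < b" "0 < d" and QQ: "0 < Q * Q"
    using nb Q by (auto simp: farey_neighbours_def)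
  have det: "b * c - a * d = 1" and dQ: "d \<le> Q" and sum: "Q \<le> b + d"
    and left: "a * (Q * Q) \<le> m * b" and right: "m * d \<le> c * (Q * Q)"
    using nb by (auto simp: farey_neighbours_def)
  have "a / b \<le> m / (Q * Q)"
    using left pos QQ by (simp add: divide_le_eq le_divide_eq mult.commute)
  also have "\<dots> \<le> \<alpha>"
    using floor(1) QQ by (simp add: divide_le_eq)
  finally have a_le: "a / b \<le> \<alpha>" .
  show ?thesis
  proof (cases "\<alpha> \<le> c / d")
    case False
    have "m / (Q * Q) \<le> c / d"
      using right pos QQ by (simp add: divide_le_eq le_divide_eq mult.commute)
    moreover have "\<alpha> < (m + 1) / (Q * Q)"
      using floor(2) QQ by (simp add: less_divide_eq)
    ultimately have "\<bar>c / d - \<alpha>\<bar> \<le> 1 / (Q * Q)"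
      using False by (simp add: add_divide_distrib)
    also have "\<dots> \<le> 1 / (d * Q)"
      using pos Q dQ by (intro divide_left_mono mult_right_mono) auto
    finally show ?thesis by simp
  next
    case le_c: True
    show ?thesis
    proof (cases "\<alpha> \<le> (a + c) / (b + d)")
      case True
      have "\<bar>a / b - \<alpha>\<bar> \<le> (a + c) / (b + d) - a / b"
        using a_le True by simp
      also have "\<dots> = (b * c - a * d) / (b * (b + d))"
        using pos by (simp add: field_simps)
      also have "\<dots> \<le> 1 / (b * Q)"
        unfolding det using pos Q sum by (intro divide_left_mono mult_left_mono) auto
      finally show ?thesis by simp
    next
      case False
      have "\<bar>c / d - \<alpha>\<bar> \<le> c / d - (a + c) / (b + d)"
        using le_c False by simp
      also have "\<dots> = (b * c - a * d) / (d * (b + d))"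
        using pos by (simp add: field_simps)
      also have "\<dots> \<le> 1 / (d * Q)"
        unfolding det using pos Q sum by (intro divide_left_mono mult_left_mono) auto
      finally show ?thesis by simp
    qed
  qed
qed

lemma unit_interval_approximation:
  assumes ip: "integer_part I" and IE1: "models_IE1 I"
    and Q: "Q \<in> I" "0 < Q"
    and unit: "0 \<le> \<alpha>" "\<alpha> < 1"
  shows "\<exists>p\<in>I. \<exists>q\<in>I. \<exists>r\<in>I. \<exists>s\<in>I.
    1 \<le> q \<and> q \<le> Q \<and> p * r + q * s = 1 \<and> \<bar>p / q - \<alpha>\<bar> \<le> 1 / (q * Q)"
proof -
  have I: "discretely_ordered I"
    using IE1 by (simp add: models_IE1_def)
  note I_intros = discretely_orderedD[OF I]
  define N where "N = Q * Q"
  have N: "N \<in> I" "0 < N"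
    using Q I_intros(5) by (auto simp: N_def)
  obtain m where m: "m \<in> I" "m \<le> \<alpha> * N" "\<alpha> * N < m + 1"
    using ip unfolding integer_part_def by blast
  have "0 < m + 1"
    using unit(1) N(2) m(3) by (meson le_less_trans less_imp_le mult_nonneg_nonneg)
  then have "0 \<le> m"
    using discretely_ordered_less_imp_add1_le[OF I I_intros(1), of "m + 1"] m(1) I_intros(2,3)
    by simp
  moreover have "m \<le> N"
  proof -
    have "\<alpha> * N \<le> 1 * N"
      using unit N(2) by (intro mult_right_mono) auto
    then show ?thesis
      using m(2) by simp
  qed
  moreover have "1 \<le> Q"
    using discretely_ordered_less_imp_add1_le[OF I I_intros(1) Q] by simp
  ultimately obtain a b c d where mem: "a \<in> I" "b \<in> I" "c \<in> I" "d \<in> I"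
    and nb: "farey_neighbours m N Q a b c d"
    using farey_neighbours_exist[OF IE1 m(1) N(1) Q(1)] by blast
  have neg: "- x \<in> I" if "x \<in> I" for x
    using I_intros(4)[OF I_intros(1) that] by simp
  have "a * (- d) + b * c = 1" "c * b + d * (- a) = 1" "1 \<le> b" "b \<le> Q" "1 \<le> d" "d \<le> Q"
    using nb by (auto simp: farey_neighbours_def algebra_simps)
  moreover have "\<bar>a / b - \<alpha>\<bar> \<le> 1 / (b * Q) \<or> \<bar>c / d - \<alpha>\<bar> \<le> 1 / (d * Q)"
    using farey_neighbour_approximates nb Q(2) m(2,3) unfolding N_def by blast
  ultimately show ?thesis
    using mem neg by meson
qed

theorem theorem4p6:
  fixes I :: "'a::linordered_field set" and \<alpha> :: 'a
  assumes "integer_part I"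
    and "models_IE1 I"
    and "\<alpha> \<notin> Frac I"
  shows "\<forall>Q\<in>I. 0 < Q \<longrightarrow>
    (\<exists>p\<in>I. \<exists>q\<in>I. 1 \<le> q \<and> q \<le> Q \<and> is_gcd_in I 1 p q \<and> \<bar>p / q - \<alpha>\<bar> \<le> 1 / (q * Q))"
proof (intro ballI impI)
  fix Q assume Q: "Q \<in> I" "0 < Q"
  have I: "discretely_ordered I"
    using assms(1) by (simp add: integer_part_def)
  note I_intros = discretely_orderedD[OF I]
  obtain f where f: "f \<in> I" "f \<le> \<alpha>" "\<alpha> < f + 1"
    using assms(1) unfolding integer_part_def by blast
  then have "0 \<le> \<alpha> - f" "\<alpha> - f < 1"
    by (simp_all add: algebra_simps)
  then obtain p q r s where mem: "p \<in> I" "q \<in> I" "r \<in> I" "s \<in> I"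
    and q: "1 \<le> q" "q \<le> Q" and det: "p * r + q * s = 1"
    and close: "\<bar>p / q - (\<alpha> - f)\<bar> \<le> 1 / (q * Q)"
    using unit_interval_approximation[OF assms(1,2) Q] by blast
  have "(p + f * q) * r + q * (s - f * r) = 1"
    using det by (simp add: algebra_simps)
  then have "is_gcd_in I 1 (p + f * q) q"
    using I mem f(1) I_intros(3-5) by (intro is_gcd_in_one_if_det_eq_one) auto
  moreover have "(p + f * q) / q - \<alpha> = p / q - (\<alpha> - f)"
    using q(1) by (simp add: add_divide_distrib)
  moreover have "p + f * q \<in> I"
    using mem f(1) I_intros(3,5) by blast
  ultimately show "\<exists>p\<in>I. \<exists>q\<in>I. 1 \<le> q \<and> q \<le> Q \<and> is_gcd_in I 1 p q \<and> \<bar>p / q - \<alpha>\<bar> \<le> 1 / (q * Q)"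
    using mem(2) q close by (intro bexI[of _ "p + f * q"] bexI[of _ q] conjI) simp_all
qed

end
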